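(* Let $M=(M_t)_{t\ge0}$ be a nonnegative supermartingale with respect to a filtration $\mathbb F=(\mathcal F_t)_{t\ge0}$ with $\mathbb E[M_0]\le1$. Let $U$ be a random variable that is uniform on $[0,1]$, or more generally stochastically larger than uniform on $[0,1]$, and independent of $\mathbb F$. Then for any $a>0$, $$P(M_\tau\ge U/a)\le a\quad\text{for every } \mathbb F\text{-stopping time }\tau.$$
   Context: Time is discrete, $t\in\{0,1,2,\dots\}$. Independence of $U$ from $\mathbb F$ means independence from $\mathcal F_\infty=\sigma(\bigcup_t\mathcal F_t)$ (so $U$ is independent of $M$ and $\tau$). Stopping times are unrestricted and may be infinite; on $\{\tau=\infty\}$, $M_\tau:=M_\infty:=\lim_{t\to\infty}M_t$, which exists almost surely. $U$ is stochastically larger than uniform on $[0,1]$ if $P(U\le u)\le u$ for all $u\in[0,1]$. *)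

theory Defs
  imports "HOL-Probability.Probability"
begin

text \<open>
  A sub-\<open>\<sigma>\<close>-algebra is represented, as in \<^theory>\<open>HOL-Probability.Conditional_Expectation\<close>, by a
  measure of which only the space and the measurable sets matter.
\<close>

definition prob_filtration :: "'a measure \<Rightarrow> (nat \<Rightarrow> 'a measure) \<Rightarrow> bool" where
  "prob_filtration P F \<longleftrightarrow> filtration (space P) F \<and> (\<forall>t. subalgebra P (F t))"

definition filtration_limit :: "'a measure \<Rightarrow> (nat \<Rightarrow> 'a measure) \<Rightarrow> 'a measure" where
  "filtration_limit P F = sigma (space P) (\<Union>t. sets (F t))"

definition supermartingale ::
    "'a measure \<Rightarrow> (nat \<Rightarrow> 'a measure) \<Rightarrow> (nat \<Rightarrow> 'a \<Rightarrow> real) \<Rightarrow> bool" where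
  "supermartingale P F M \<longleftrightarrow>
     (\<forall>t. M t \<in> borel_measurable (F t)) \<and>
     (\<forall>t. integrable P (M t)) \<and>
     (\<forall>t. AE x in P. real_cond_exp P (F t) (M (Suc t)) x \<le> M t x)"

text \<open>
  Stopping times may be infinite, hence are \<^typ>\<open>enat\<close>-valued, whereas \<^const>\<open>stopping_time\<close> wants
  the filtration to be indexed by the type of values of the stopping time.  The filtration is
  therefore extended to the index \<open>\<infinity>\<close>; the condition at \<open>\<infinity>\<close> is vacuous, see
  \<open>enat_stopping_time_iff\<close>.
\<close>

definition enat_stopping_time ::
    "'a measure \<Rightarrow> (nat \<Rightarrow> 'a measure) \<Rightarrow> ('a \<Rightarrow> enat) \<Rightarrow> bool" where
  "enat_stopping_time P F \<tau> \<longleftrightarrow> stopping_time (case_enat F (filtration_limit P F)) \<tau>"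

lemma enat_stopping_time_iff:
  "enat_stopping_time P F \<tau> \<longleftrightarrow> (\<forall>t. Measurable.pred (F t) (\<lambda>x. \<tau> x \<le> enat t))"
  unfolding enat_stopping_time_def stopping_time_def
  by (auto split: enat.split)

text \<open>
  On paths that do not converge (a null set for a nonnegative supermartingale) \<^const>\<open>lim\<close> is a fixed
  unspecified real, the same for all such paths, so measurability is not affected.
\<close>

definition stopped_value :: "(nat \<Rightarrow> 'a \<Rightarrow> real) \<Rightarrow> ('a \<Rightarrow> enat) \<Rightarrow> 'a \<Rightarrow> real" where
  "stopped_value M \<tau> x = (case \<tau> x of enat t \<Rightarrow> M t x | \<infinity> \<Rightarrow> lim (\<lambda>t. M t x))"

definition stochastically_larger_uniform :: "'a measure \<Rightarrow> ('a \<Rightarrow> real) \<Rightarrow> bool" where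
  "stochastically_larger_uniform P U \<longleftrightarrow>
     (\<forall>u\<in>{0..1}. measure P {x \<in> space P. U x \<le> u} \<le> u)"

definition indep_of_filtration ::
    "'a measure \<Rightarrow> (nat \<Rightarrow> 'a measure) \<Rightarrow> ('a \<Rightarrow> real) \<Rightarrow> bool" where
  "indep_of_filtration P F U \<longleftrightarrow>
     prob_space.indep_set P (sets (vimage_algebra (space P) U borel)) (sets (filtration_limit P F))"

lemma uniform_imp_stochastically_larger_uniform:
  assumes U: "U \<in> borel_measurable P"
    and unif: "distr P borel U = uniform_measure lborel {0..1}"
  shows "stochastically_larger_uniform P U"
  unfolding stochastically_larger_uniform_def
proof
  fix u :: real assume u: "u \<in> {0..1}"
  have "measure P {x \<in> space P. U x \<le> u} = measure (distr P borel U) {..u}"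
    using U by (subst measure_distr) (auto intro!: arg_cong[where f = "measure P"])
  also have "\<dots> = measure lborel ({0..1} \<inter> {..u})"
    unfolding unif by (subst measure_uniform_measure) auto
  also have "{0..1} \<inter> {..u} = {0..u}"
    using u by auto
  finally show "measure P {x \<in> space P. U x \<le> u} \<le> u"
    using u by simp
qed

lemma measurable_stopped_value:
  assumes F: "prob_filtration P F" and M: "\<And>t. M t \<in> borel_measurable (F t)"
    and \<tau>: "enat_stopping_time P F \<tau>"
  shows "stopped_value M \<tau> \<in> borel_measurable P"
proof -
  have M' [measurable]: "M t \<in> borel_measurable P" for t
    using F M by (auto simp: prob_filtration_def intro: measurable_from_subalg)
  have le: "Measurable.pred P (\<lambda>x. \<tau> x \<le> enat t)" for t
    using F \<tau> by (auto simp: prob_filtration_def enat_stopping_time_iff intro: measurable_from_subalg)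
  have [measurable]: "Measurable.pred P (\<lambda>x. \<tau> x = enat t)" for t
  proof (cases t)
    case 0
    then show ?thesis using le[of 0] by (simp add: zero_enat_def[symmetric])
  next
    case (Suc s)
    have "\<tau> x = enat t \<longleftrightarrow> \<tau> x \<le> enat t \<and> \<not> \<tau> x \<le> enat s" for x
      using Suc by (cases "\<tau> x") auto
    then show ?thesis using le[of t] le[of s] by simp
  qed
  have \<tau>_meas [measurable]: "\<tau> \<in> measurable P (count_space UNIV)"
  proof (rule measurable_count_space_eq2_countable[THEN iffD2], intro conjI ballI funcsetI UNIV_I)
    fix n :: enat
    have "Measurable.pred P (\<lambda>x. \<tau> x = n)"
    proof (cases n)
      case infinity
      have "\<tau> x = \<infinity> \<longleftrightarrow> (\<forall>t. \<tau> x \<noteq> enat t)" for x by (cases "\<tau> x") auto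
      then have "(\<lambda>x. \<tau> x = n) = (\<lambda>x. \<forall>t. \<not> \<tau> x = enat t)"
        using infinity by (intro ext) blast
      moreover have "Measurable.pred P (\<lambda>x. \<forall>t. \<not> \<tau> x = enat t)"
        by measurable
      ultimately show ?thesis by (simp only:)
    qed simp
    then show "\<tau> -` {n} \<inter> space P \<in> sets P"
      by (auto simp: pred_def vimage_def Int_def conj_commute)
  qed
  have "(\<lambda>x. (\<lambda>n x. case n of enat t \<Rightarrow> M t x | \<infinity> \<Rightarrow> lim (\<lambda>t. M t x)) (\<tau> x) x)
          \<in> borel_measurable P"
    by (rule measurable_compose_countable[OF _ \<tau>_meas])
       (auto split: enat.split intro: borel_measurable_lim_metric)
  then show ?thesis
    by (simp add: stopped_value_def[abs_def])
qed

end

theory Submission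
  imports Defs
begin

text \<open>
  The proof combines Fubini with optional stopping. Conditionally on the stopped value \<open>X\<close>, which is
  independent of \<open>U\<close>, the event \<open>U \<le> a X\<close> has probability at most \<open>a X\<close>, so it suffices that
  \<open>\<E> X \<le> 1\<close>. For infinite stopping times this needs the almost sure convergence of \<open>M\<close>, which follows
  from an upcrossing argument: buying at a level below \<open>p\<close> and selling at a level above \<open>q\<close> gains at
  least \<open>q - p\<close> per sale and never loses more than \<open>\<bar>p\<bar>\<close> overall. The expected number of sales is
  therefore bounded, and by Borel--Cantelli only finitely many sales occur.
\<close>

section \<open>Upcrossings of a real sequence\<close>

text \<open>State of the strategy after trading at time \<open>n\<close>: buy at a price at most
  \<open>p\<close>, sell at a price at least \<open>q\<close>. The recursion reads only
  \<open>f 0\<close>, ..., \<open>f n\<close>, so the position is known before the increment from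
  \<open>n\<close> to \<open>Suc n\<close>. It also makes adaptedness a plain induction, without a
  sequence of hitting times.\<close>

primrec holding :: "real \<Rightarrow> real \<Rightarrow> (nat \<Rightarrow> real) \<Rightarrow> nat \<Rightarrow> bool" where
  "holding p q f 0 \<longleftrightarrow> f 0 \<le> p"
| "holding p q f (Suc n) \<longleftrightarrow> (if holding p q f n then f (Suc n) < q else f (Suc n) \<le> p)"

text \<open>Indexed by the last time at which the position is held; the sale itself takes place at
  \<open>Suc n\<close>.\<close>

definition sale :: "real \<Rightarrow> real \<Rightarrow> (nat \<Rightarrow> real) \<Rightarrow> nat \<Rightarrow> bool" where
  "sale p q f n \<longleftrightarrow> holding p q f n \<and> q \<le> f (Suc n)"

text \<open>A cautious account of the gain: every completed trade is credited with exactly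
  \<open>q - p\<close>, and an open position is valued as if bought at \<open>p\<close>. The true
  gain is at least this, and the number of sales can be read off directly.\<close>

definition trading_gain :: "real \<Rightarrow> real \<Rightarrow> (nat \<Rightarrow> real) \<Rightarrow> nat \<Rightarrow> real" where
  "trading_gain p q f n =
     (q - p) * (\<Sum>k<n. of_bool (sale p q f k)) + of_bool (holding p q f n) * (f n - p)"

lemma trading_gain_0: "trading_gain p q f 0 \<le> 0"
  by (simp add: trading_gain_def)

text \<open>Holding without a sale gives equality. A sale is booked at \<open>q\<close> although the
  price is at least \<open>q\<close>, and a purchase is booked at \<open>p\<close> although the
  price is at most \<open>p\<close>; both only lower the left-hand side.\<close>

lemma trading_gain_Suc:
  "trading_gain p q f (Suc n) - trading_gain p q f n
     \<le> of_bool (holding p q f n) * (f (Suc n) - f n)"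
  by (auto simp: trading_gain_def sale_def algebra_simps)

text \<open>A low value leads to a position, which is kept until it is sold; the next high value
  forces the sale.\<close>

lemma frequently_sale:
  assumes low: "\<exists>\<^sub>F n in sequentially. f n \<le> p" and high: "\<exists>\<^sub>F n in sequentially. q \<le> f n"
  shows "\<exists>\<^sub>F n in sequentially. sale p q f n"
  unfolding frequently_sequentially
proof
  fix n
  \<comment> \<open>\<open>Suc n\<close> leaves room for \<open>k - 1\<close>: a position held there
    may be sold at \<open>k\<close>, and without one there is a purchase at
    \<open>k\<close>.\<close>
  obtain k where k: "k \<ge> Suc n" "f k \<le> p"
    using low unfolding frequently_sequentially by blast
  obtain m where m: "m \<ge> n" "holding p q f m"
  proof (cases "holding p q f (k - 1)")
    case True
    then show ?thesis using k that[of "k - 1"] by simp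
  next
    case False
    then have "holding p q f k" using k by (cases k) auto
    then show ?thesis using k that[of k] by simp
  qed
  obtain j where j: "j \<ge> Suc m" "q \<le> f j"
    using high unfolding frequently_sequentially by blast
  show "\<exists>i\<ge>n. sale p q f i"
  proof (rule ccontr)
    assume "\<not> (\<exists>i\<ge>n. sale p q f i)"
    then have no: "\<not> sale p q f i" if "i \<ge> m" for i
      using that m by auto
    have "holding p q f i" if "i \<ge> m" for i
      using that
    proof (induction i rule: dec_induct)
      case (step i)
      then show ?case using no[of i] by (auto simp: sale_def)
    qed (use m in simp)
    moreover obtain i where "j = Suc i" "i \<ge> m"
      using j by (cases j) auto
    ultimately show False
      using no[of i] j by (simp add: sale_def)
  qed
qed

text \<open>If the limit inferior were below the limit superior, two rationals strictly between them
  would be crossed infinitely often. A bound along infinitely many indices suffices to exclude the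
  limit \<infinity>, and this is the kind of bound that Fatou's lemma provides.\<close>

lemma convergent_if_no_oscillation:
  fixes f :: "nat \<Rightarrow> real"
  assumes nonneg: "\<And>n. 0 \<le> f n"
    and osc: "\<And>p q :: rat. p < q \<Longrightarrow>
      \<not> ((\<exists>\<^sub>F n in sequentially. f n \<le> of_rat p) \<and> (\<exists>\<^sub>F n in sequentially. of_rat q \<le> f n))"
    and bdd: "\<exists>\<^sub>F n in sequentially. f n \<le> K"
  shows "convergent f"
proof -
  define g where "g = (\<lambda>n. ereal (f n))"
  have "liminf g = limsup g"
  proof (rule ccontr)
    assume "liminf g \<noteq> limsup g"
    then have "liminf g < limsup g"
      using Liminf_le_Limsup[of sequentially g] by simp
    then obtain q where q: "liminf g < real_of_rat q" "real_of_rat q < limsup g"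
      using ereal_dense3 by blast
    obtain p where p: "liminf g < real_of_rat p" "ereal (real_of_rat p) < real_of_rat q"
      using ereal_dense3[OF q(1)] by blast
    have "\<exists>\<^sub>F n in sequentially. f n \<le> of_rat p"
      unfolding frequently_def
    proof
      assume "\<forall>\<^sub>F n in sequentially. \<not> f n \<le> real_of_rat p"
      then have "ereal (of_rat p) \<le> liminf g"
        by (intro Liminf_bounded) (auto simp: g_def elim: eventually_mono)
      then show False using p by simp
    qed
    moreover have "\<exists>\<^sub>F n in sequentially. of_rat q \<le> f n"
      unfolding frequently_def
    proof
      assume "\<forall>\<^sub>F n in sequentially. \<not> real_of_rat q \<le> f n"
      then have "limsup g \<le> ereal (of_rat q)"
        by (intro Limsup_bounded) (auto simp: g_def elim: eventually_mono)
      then show False using q by simp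
    qed
    ultimately show False using osc[of p q] p by (simp add: of_rat_less)
  qed
  then have lim: "g \<longlonglongrightarrow> liminf g"
    by (intro Liminf_eq_Limsup) auto
  have "0 \<le> liminf g"
    by (intro Liminf_bounded) (auto simp: g_def nonneg)
  moreover have "liminf g \<le> ereal K"
  proof (rule ccontr)
    assume "\<not> liminf g \<le> ereal K"
    then have "\<forall>\<^sub>F n in sequentially. ereal K < g n"
      by (intro less_LiminfD) simp
    then show False
      using bdd by (auto simp: g_def frequently_def not_le)
  qed
  ultimately obtain l where "liminf g = ereal l"
    by (cases "liminf g") auto
  then show ?thesis
    using lim by (auto simp: g_def convergent_def)
qed

section \<open>Nonnegative supermartingales\<close>

locale nonneg_supermartingale = prob_space P
  for P :: "'a measure" and F :: "nat \<Rightarrow> 'a measure" and M :: "nat \<Rightarrow> 'a \<Rightarrow> real" +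
  assumes filtration: "prob_filtration P F"
    and supermartingale: "supermartingale P F M"
    and nonneg: "AE x in P. 0 \<le> M t x"
begin

lemma subalgebra_F: "subalgebra P (F t)"
  using filtration by (simp add: prob_filtration_def)

lemma space_F: "space (F t) = space P"
  using subalgebra_F by (simp add: subalgebra_def)

lemma sets_F_subset: "s \<le> t \<Longrightarrow> sets (F s) \<subseteq> sets (F t)"
  using filtration by (simp add: prob_filtration_def filtration_def)

lemma subalgebra_F_F: "s \<le> t \<Longrightarrow> subalgebra (F t) (F s)"
  by (simp add: subalgebra_def space_F sets_F_subset)

lemma adapted: "s \<le> t \<Longrightarrow> M s \<in> borel_measurable (F t)"
  using supermartingale subalgebra_F_F
  by (auto simp: supermartingale_def intro: measurable_from_subalg)

lemma integrable_M [simp]: "integrable P (M t)"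
  using supermartingale by (simp add: supermartingale_def)

lemma borel_measurable_M [measurable]: "M t \<in> borel_measurable P"
  using integrable_M by (rule borel_measurable_integrable)

text \<open>On a set of \<open>F t\<close>, \<open>M (Suc t)\<close> has the same integral as its
  conditional expectation, which is almost surely at most \<open>M t\<close>.\<close>

lemma integral_step_nonpos:
  assumes A: "A \<in> sets (F t)"
  shows "(\<integral>x. indicator A x * (M (Suc t) x - M t x) \<partial>P) \<le> 0"
proof -
  interpret finite_measure_subalgebra P "F t"
    by unfold_locales (rule subalgebra_F)
  have AP [measurable]: "A \<in> sets P"
    using A subalgebra_F by (auto simp: subalgebra_def)
  have int: "integrable P (\<lambda>x. indicator A x * f x)" if "integrable P f" for f :: "'a \<Rightarrow> real"
    using integrable_mult_indicator[OF AP that] by simp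
  have "(\<integral>x. indicator A x * M (Suc t) x \<partial>P)
      = (\<integral>x. indicator A x * real_cond_exp P (F t) (M (Suc t)) x \<partial>P)"
    using real_cond_exp_intA[OF integrable_M A, of "Suc t"]
    by (simp add: set_lebesgue_integral_def)
  also have "\<dots> \<le> (\<integral>x. indicator A x * M t x \<partial>P)"
  proof (rule integral_mono_AE)
    have "AE x in P. real_cond_exp P (F t) (M (Suc t)) x \<le> M t x"
      using supermartingale by (simp add: supermartingale_def)
    then show "AE x in P. indicator A x * real_cond_exp P (F t) (M (Suc t)) x
        \<le> indicator A x * M t x"
      by eventually_elim (simp add: indicator_def)
  qed (simp_all add: int real_cond_exp_int)
  finally show ?thesis
    by (simp add: right_diff_distrib int)
qed

text \<open>Martingale transform with stakes 0 or 1, in a form that only asks the increments of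
  \<open>G\<close> to be dominated. It serves for the trading gain, for \<open>M\<close> itself and
  for the stopped process.\<close>

lemma expectation_transform_le:
  assumes int: "\<And>n. integrable P (G n)"
    and A: "\<And>n. A n \<in> sets (F n)"
    and step: "\<And>n x. x \<in> space P \<Longrightarrow> G (Suc n) x - G n x \<le> indicator (A n) x * (M (Suc n) x - M n x)"
  shows "expectation (G n) \<le> expectation (G 0)"
proof (induction n)
  case (Suc n)
  have AP [measurable]: "A n \<in> sets P"
    using A subalgebra_F by (auto simp: subalgebra_def)
  have "expectation (G (Suc n)) - expectation (G n) = expectation (\<lambda>x. G (Suc n) x - G n x)"
    by (simp add: int)
  also have "\<dots> \<le> (\<integral>x. indicator (A n) x * (M (Suc n) x - M n x) \<partial>P)"
    using integrable_mult_indicator[OF AP, of "\<lambda>x. M (Suc n) x - M n x"]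
    by (intro integral_mono) (auto intro: int step)
  also have "\<dots> \<le> 0"
    by (rule integral_step_nonpos[OF A])
  finally show ?case using Suc by simp
qed simp

section \<open>Almost sure convergence\<close>

text \<open>The index \<open>t\<close> of the \<sigma>-algebra is kept apart from \<open>n\<close>
  so that it stays fixed during the induction.\<close>

lemma pred_holding: "n \<le> t \<Longrightarrow> Measurable.pred (F t) (\<lambda>x. holding p q (\<lambda>s. M s x) n)"
proof (induction n)
  case 0
  note adapted[OF 0, measurable]
  show ?case by simp
next
  case (Suc n)
  note adapted[OF Suc.prems, measurable]
  have [measurable]: "Measurable.pred (F t) (\<lambda>x. holding p q (\<lambda>s. M s x) n)"
    using Suc by simp
  show ?case by simp
qed

lemma pred_holding' [measurable]: "Measurable.pred P (\<lambda>x. holding p q (\<lambda>s. M s x) n)"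
  using pred_holding[OF order_refl] subalgebra_F by (rule measurable_from_subalg[rotated])

lemma pred_sale [measurable]: "Measurable.pred P (\<lambda>x. sale p q (\<lambda>s. M s x) n)"
  by (simp add: sale_def)

lemma integrable_trading_gain: "integrable P (\<lambda>x. trading_gain p q (\<lambda>s. M s x) n)"
  unfolding trading_gain_def
proof (intro Bochner_Integration.integrable_add integrable_mult_right
    Bochner_Integration.integrable_sum)
  show "integrable P (\<lambda>x. of_bool (sale p q (\<lambda>s. M s x) k) :: real)" for k
    by (rule integrable_const_bound[where B = 1]) auto
  show "integrable P (\<lambda>x. of_bool (holding p q (\<lambda>s. M s x) n) * (M n x - p))"
    by (rule Bochner_Integration.integrable_bound[where f = "\<lambda>x. M n x - p"]) auto
qed

lemma expectation_trading_gain: "expectation (\<lambda>x. trading_gain p q (\<lambda>s. M s x) n) \<le> 0"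
proof -
  define A where "A n = {x \<in> space P. holding p q (\<lambda>s. M s x) n}" for n
  have "A n \<in> sets (F n)" for n
    using pred_holding[of n n p q] by (simp add: A_def pred_def space_F)
  then have "expectation (\<lambda>x. trading_gain p q (\<lambda>s. M s x) n)
      \<le> expectation (\<lambda>x. trading_gain p q (\<lambda>s. M s x) 0)"
  proof (intro expectation_transform_le[where A = A] integrable_trading_gain)
    fix n x assume "x \<in> space P"
    then show "trading_gain p q (\<lambda>s. M s x) (Suc n) - trading_gain p q (\<lambda>s. M s x) n
        \<le> indicator (A n) x * (M (Suc n) x - M n x)"
      using trading_gain_Suc[of p q "\<lambda>s. M s x" n] by (simp add: A_def indicator_def of_bool_def)
  qed
  also have "\<dots> \<le> 0"
    using integral_mono[OF integrable_trading_gain[of p q 0] integrable_zero] trading_gain_0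
    by simp
  finally show ?thesis .
qed

lemma AE_eventually_no_sale:
  assumes "p < q"
  shows "AE x in P. \<forall>\<^sub>F n in sequentially. \<not> sale p q (\<lambda>s. M s x) n"
proof -
  define S where "S n = {x \<in> space P. sale p q (\<lambda>s. M s x) n}" for n
  have S [measurable]: "S n \<in> sets P" for n
    by (simp add: S_def)
  \<comment> \<open>Since \<open>M n\<close> is almost surely nonnegative, an open position is worth
    at least \<open>-p\<close>, and no position is worth 0. Subtracting \<open>\<bar>p\<bar>\<close>
    covers both cases for either sign of \<open>p\<close>, and the resulting bound does not depend
    on \<open>n\<close>.\<close>
  have "(\<Sum>k<n. prob (S k)) \<le> \<bar>p\<bar> / (q - p)" for n
  proof -
    have "(q - p) * (\<Sum>k<n. prob (S k)) - \<bar>p\<bar>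
        = expectation (\<lambda>x. (q - p) * (\<Sum>k<n. indicator (S k) x) - \<bar>p\<bar>)"
      by (simp add: Bochner_Integration.integral_sum prob_space emeasure_eq_measure
          del: sum_mult_indicator sum_indicator_mult)
    also have "\<dots> \<le> expectation (\<lambda>x. trading_gain p q (\<lambda>s. M s x) n)"
    proof (rule integral_mono_AE)
      show "AE x in P. (q - p) * (\<Sum>k<n. indicator (S k) x) - \<bar>p\<bar>
          \<le> trading_gain p q (\<lambda>s. M s x) n"
        using nonneg[of n] AE_space
      proof eventually_elim
        case (elim x)
        then have "(\<Sum>k<n. indicator (S k) x) = (\<Sum>k<n. of_bool (sale p q (\<lambda>s. M s x) k) :: real)"
          by (intro sum.cong) (auto simp: S_def indicator_def)
        with elim show ?case
          by (auto simp: trading_gain_def)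
      qed
    qed (auto intro!: integrable_trading_gain Bochner_Integration.integrable_sum
        simp: emeasure_eq_measure simp del: sum_indicator_mult)
    also have "\<dots> \<le> 0"
      by (rule expectation_trading_gain)
    finally show ?thesis
      using assms by (simp add: field_simps)
  qed
  then have "summable (\<lambda>n. prob (S n))"
    by (intro summableI_nonneg_bounded) auto
  then have "AE x in P. \<forall>\<^sub>F n in sequentially. x \<in> space P - S n"
    by (intro borel_cantelli_AE1) (auto simp: emeasure_eq_measure)
  then show ?thesis
    by eventually_elim (auto simp: S_def elim: eventually_mono)
qed

lemma nn_integral_M_le: "(\<integral>\<^sup>+x. ennreal (M n x) \<partial>P) \<le> ennreal (expectation (M 0))"
proof -
  \<comment> \<open>Stake 1 at all times, that is \<open>A = space P\<close>, makes the transform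
    \<open>M\<close> itself.\<close>
  have "expectation (M n) \<le> expectation (M 0)"
    by (rule expectation_transform_le[where A = "\<lambda>_. space P"])
       (use sets.top[of "F k" for k] in \<open>auto simp: space_F\<close>)
  then show ?thesis
    by (subst nn_integral_eq_integral) (auto intro: nonneg ennreal_leI)
qed

text \<open>By Fatou's lemma the limit inferior has finite integral, hence is almost surely finite.
  This bounds the path along infinitely many indices.\<close>

lemma AE_frequently_bounded: "AE x in P. \<exists>K. \<exists>\<^sub>F n in sequentially. M n x \<le> K"
proof -
  have "(\<integral>\<^sup>+x. liminf (\<lambda>n. ennreal (M n x)) \<partial>P) \<le> liminf (\<lambda>n. \<integral>\<^sup>+x. ennreal (M n x) \<partial>P)"
    by (rule nn_integral_liminf) simp
  also have "\<dots> \<le> ennreal (expectation (M 0))"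
    by (rule Liminf_le) (auto simp: nn_integral_M_le)
  finally have "AE x in P. liminf (\<lambda>n. ennreal (M n x)) \<noteq> \<infinity>"
    by (intro nn_integral_PInf_AE) (auto simp: top_unique)
  then show ?thesis
  proof eventually_elim
    case (elim x)
    then obtain K where K: "liminf (\<lambda>n. ennreal (M n x)) < ennreal K" "0 \<le> K"
      using that[of "enn2real (liminf (\<lambda>n. ennreal (M n x))) + 1"]
      by (cases "liminf (\<lambda>n. ennreal (M n x))") (auto simp: ennreal_less_iff)
    have "\<exists>\<^sub>F n in sequentially. M n x \<le> K"
      unfolding frequently_def
    proof
      assume "\<forall>\<^sub>F n in sequentially. \<not> M n x \<le> K"
      then have "ennreal K \<le> liminf (\<lambda>n. ennreal (M n x))"
        by (intro Liminf_bounded) (auto elim!: eventually_mono intro: ennreal_leI)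
      with K show False by simp
    qed
    then show ?case ..
  qed
qed

text \<open>Restricting the levels to rationals leaves countably many exceptional null sets, so
  almost every path avoids all of them at once.\<close>

lemma AE_convergent: "AE x in P. convergent (\<lambda>n. M n x)"
proof -
  have "AE x in P. \<forall>p q :: rat. p < q \<longrightarrow>
      (\<forall>\<^sub>F n in sequentially. \<not> sale (of_rat p) (of_rat q) (\<lambda>s. M s x) n)"
    unfolding AE_all_countable using AE_eventually_no_sale by (auto simp: of_rat_less)
  moreover have "AE x in P. \<forall>n. 0 \<le> M n x"
    unfolding AE_all_countable using nonneg by simp
  ultimately show ?thesis
    using AE_frequently_bounded
  proof eventually_elim
    case (elim x)
    then obtain K where K: "\<exists>\<^sub>F n in sequentially. M n x \<le> K"
      by blast
    show ?case
    proof (rule convergent_if_no_oscillation[OF _ _ K])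
      fix p q :: rat assume "p < q"
      then have "\<not> (\<exists>\<^sub>F n in sequentially. sale (of_rat p) (of_rat q) (\<lambda>n. M n x) n)"
        using elim by (simp add: not_frequently)
      then show "\<not> ((\<exists>\<^sub>F n in sequentially. M n x \<le> of_rat p) \<and>
          (\<exists>\<^sub>F n in sequentially. of_rat q \<le> M n x))"
        using frequently_sale[of "\<lambda>n. M n x" "of_rat p" "of_rat q"] by blast
    qed (use elim in simp)
  qed
qed

section \<open>Optional stopping\<close>

lemma pred_not_stopped:
  assumes "enat_stopping_time P F \<tau>"
  shows "{x \<in> space P. enat n < \<tau> x} \<in> sets (F n)"
proof -
  have [measurable]: "Measurable.pred (F n) (\<lambda>x. \<tau> x \<le> enat n)"
    using assms by (simp add: enat_stopping_time_iff)
  have "Measurable.pred (F n) (\<lambda>x. \<not> \<tau> x \<le> enat n)"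
    by measurable
  then show ?thesis
    by (simp add: pred_def space_F not_le)
qed

text \<open>The process stopped at \<tau> is the transform with stake 1 as long as
  \<open>n < \<tau>\<close>, so its expectations stay below that of \<open>M 0\<close>. It converges
  almost surely to the stopped value, and Fatou's lemma carries the bound to the limit.\<close>

lemma nn_integral_stopped_value_le:
  assumes \<tau>: "enat_stopping_time P F \<tau>"
  shows "(\<integral>\<^sup>+x. ennreal (stopped_value M \<tau> x) \<partial>P) \<le> ennreal (expectation (M 0))"
proof -
  define A where "A n = {x \<in> space P. enat n < \<tau> x}" for n
  have A: "A n \<in> sets (F n)" for n
    unfolding A_def by (rule pred_not_stopped[OF \<tau>])
  then have AP [measurable]: "A n \<in> sets P" for n
    using subalgebra_F by (auto simp: subalgebra_def)
  \<comment> \<open>\<open>S n\<close> is \<open>M\<close> at time \<open>min n \<tau>\<close>,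
    written as a telescoping sum so that its increments have the form needed for the
    transform.\<close>
  define S where "S n x = M 0 x + (\<Sum>k<n. indicator (A k) x * (M (Suc k) x - M k x))" for n x
  have S_int: "integrable P (S n)" for n
    unfolding S_def
  proof (intro Bochner_Integration.integrable_add Bochner_Integration.integrable_sum integrable_M)
    show "integrable P (\<lambda>x. indicator (A k) x * (M (Suc k) x - M k x))" for k
      using integrable_mult_indicator[OF AP, of "\<lambda>x. M (Suc k) x - M k x"] by simp
  qed
  \<comment> \<open>\<open>the_enat\<close> is evaluated only for \<open>\<tau> x < enat n\<close>,
    hence at a finite value.\<close>
  have S_eq: "S n x = (if enat n \<le> \<tau> x then M n x else M (the_enat (\<tau> x)) x)"
    if "x \<in> space P" for n x
  proof (induction n)
    case 0
    then show ?case by (simp add: S_def zero_enat_def[symmetric])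
  next
    case (Suc n)
    have "S (Suc n) x = S n x + indicator (A n) x * (M (Suc n) x - M n x)"
      by (simp add: S_def)
    with Suc that show ?case
      by (cases "\<tau> x") (auto simp: A_def indicator_def not_less_eq_eq le_antisym not_le)
  qed
  have S_nonneg: "AE x in P. 0 \<le> S n x" for n
  proof -
    have "AE x in P. \<forall>n. 0 \<le> M n x"
      unfolding AE_all_countable using nonneg by simp
    then show ?thesis
      using AE_space by eventually_elim (simp add: S_eq)
  qed
  have S_exp: "(\<integral>\<^sup>+x. ennreal (S n x) \<partial>P) \<le> ennreal (expectation (M 0))" for n
  proof -
    have "expectation (S n) \<le> expectation (S 0)"
      by (rule expectation_transform_le[OF S_int A]) (simp add: S_def)
    then have "expectation (S n) \<le> expectation (M 0)"
      by (simp add: S_def[abs_def])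
    then show ?thesis
      using S_int S_nonneg by (subst nn_integral_eq_integral) (auto intro: ennreal_leI)
  qed
  \<comment> \<open>The sequence is eventually constant if \<open>\<tau> x\<close> is finite.
    Otherwise it is the path of \<open>M\<close>, and convergence makes \<open>lim\<close> its true
    limit.\<close>
  have "AE x in P. (\<lambda>n. S n x) \<longlonglongrightarrow> stopped_value M \<tau> x"
    using AE_convergent AE_space
  proof eventually_elim
    case (elim x)
    show ?case
    proof (cases "\<tau> x")
      case (enat t)
      have "\<forall>\<^sub>F n in sequentially. S n x = stopped_value M \<tau> x"
        using eventually_ge_at_top[of t]
        by eventually_elim (use elim enat in \<open>auto simp: S_eq stopped_value_def\<close>)
      then show ?thesis
        by (rule tendsto_eventually)
    next
      case infinity
      with elim show ?thesis
        by (simp add: S_eq stopped_value_def convergent_LIMSEQ_iff)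
    qed
  qed
  then have "(\<integral>\<^sup>+x. ennreal (stopped_value M \<tau> x) \<partial>P)
      = (\<integral>\<^sup>+x. liminf (\<lambda>n. ennreal (S n x)) \<partial>P)"
    by (intro nn_integral_cong_AE)
       (auto elim!: eventually_mono intro!: lim_imp_Liminf[symmetric] tendsto_ennrealI)
  also have "\<dots> \<le> liminf (\<lambda>n. \<integral>\<^sup>+x. ennreal (S n x) \<partial>P)"
    using S_int by (intro nn_integral_liminf) auto
  also have "\<dots> \<le> ennreal (expectation (M 0))"
    by (rule Liminf_le) (auto simp: S_exp)
  finally show ?thesis .
qed

text \<open>Convergence enters because \<open>lim\<close> of a divergent path is an unspecified real
  that might be negative.\<close>

lemma AE_stopped_value_nonneg: "AE x in P. 0 \<le> stopped_value M \<tau> x"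
proof -
  have "AE x in P. \<forall>n. 0 \<le> M n x"
    unfolding AE_all_countable using nonneg by simp
  then show ?thesis
    using AE_convergent
  proof eventually_elim
    case (elim x)
    then have "0 \<le> lim (\<lambda>n. M n x)"
      by (intro LIMSEQ_le_const) (auto simp: convergent_LIMSEQ_iff)
    with elim show ?case
      by (simp add: stopped_value_def split: enat.split)
  qed
qed

lemma space_filtration_limit: "space (filtration_limit P F) = space P"
  by (simp add: filtration_limit_def space_measure_of_conv)

lemma sets_F_filtration_limit: "sets (F t) \<subseteq> sets (filtration_limit P F)"
proof -
  have "(\<Union>t. sets (F t)) \<subseteq> Pow (space P)"
    using sets.sets_into_space space_F by blast
  then show ?thesis
    by (auto simp: filtration_limit_def)
qed

text \<open>Independence of \<open>U\<close> concerns the limit \<sigma>-algebra, so measurability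
  with respect to \<open>P\<close> is too weak. The general measurability lemma is applied with
  \<open>filtration_limit P F\<close> in the role of the ambient measure.\<close>

lemma stopped_value_filtration_limit:
  assumes "enat_stopping_time P F \<tau>"
  shows "stopped_value M \<tau> \<in> borel_measurable (filtration_limit P F)"
proof (rule measurable_stopped_value)
  show "prob_filtration (filtration_limit P F) F"
    using filtration sets_F_filtration_limit
    by (auto simp: prob_filtration_def space_filtration_limit subalgebra_def)
  show "enat_stopping_time (filtration_limit P F) F \<tau>"
    using assms by (simp add: enat_stopping_time_iff)
qed (rule adapted, simp)

end

section \<open>Randomised thresholds\<close>

text \<open>Extends the defining bound beyond 1, where it is trivial, because the random threshold
  may exceed 1.\<close>

lemma (in prob_space) stochastically_larger_uniform_le:
  assumes U: "stochastically_larger_uniform M U" and "0 \<le> u"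
  shows "prob {x \<in> space M. U x \<le> u} \<le> u"
proof (cases "u \<le> 1")
  case True
  then show ?thesis
    using assms by (simp add: stochastically_larger_uniform_def)
next
  case False
  then show ?thesis
    using prob_le_1[of "{x \<in> space M. U x \<le> u}"] by linarith
qed

text \<open>A randomised Markov inequality: the constant \<open>U = 1\<close> gives the classical
  one. Independence turns the joint law into a product, and the bound on \<open>U\<close> is applied
  for each fixed value of \<open>X\<close>.\<close>

lemma (in prob_space) emeasure_le_randomised_threshold:
  assumes indep: "indep_var borel X borel U"
    and U: "stochastically_larger_uniform M U"
    and X_nonneg: "AE x in M. 0 \<le> X x"
  shows "emeasure M {x \<in> space M. U x \<le> X x} \<le> (\<integral>\<^sup>+x. ennreal (X x) \<partial>M)"
proof -
  have [measurable]: "X \<in> borel_measurable M" "U \<in> borel_measurable M"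
    using indep by (auto dest: indep_var_rv1 indep_var_rv2)
  interpret DU: prob_space "distr M borel U"
    by (rule prob_space_distr) simp
  define T :: "(real \<times> real) set" where "T = {z. snd z \<le> fst z}"
  have T [measurable]: "T \<in> sets (borel \<Otimes>\<^sub>M borel)"
  proof -
    have "{z \<in> space (borel \<Otimes>\<^sub>M borel). snd z \<le> fst z} \<in> sets (borel \<Otimes>\<^sub>M (borel :: real measure))"
      by measurable
    then show ?thesis by (simp add: T_def space_pair_measure)
  qed
  have "emeasure M {x \<in> space M. U x \<le> X x}
      = emeasure (distr M (borel \<Otimes>\<^sub>M borel) (\<lambda>x. (X x, U x))) T"
    by (subst emeasure_distr[OF _ T]) (auto simp: T_def intro!: arg_cong[where f = "emeasure M"])
  also have "\<dots> = emeasure (distr M borel X \<Otimes>\<^sub>M distr M borel U) T"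
    using indep by (simp add: indep_var_distribution_eq)
  \<comment> \<open>The section of \<open>T\<close> at \<open>y\<close> is the half-line of all
    reals at most \<open>y\<close>, so the integrand is the distribution function of
    \<open>U\<close> at \<open>y\<close>.\<close>
  also have "\<dots> = (\<integral>\<^sup>+y. emeasure (distr M borel U) (Pair y -` T) \<partial>distr M borel X)"
    by (rule DU.emeasure_pair_measure_alt) (simp cong: sets_pair_measure_cong)
  also have "\<dots> = (\<integral>\<^sup>+x. emeasure (distr M borel U) (Pair (X x) -` T) \<partial>M)"
    by (rule nn_integral_distr)
       (auto intro!: DU.measurable_emeasure_Pair simp: measurable_distr_eq1)
  also have "\<dots> \<le> (\<integral>\<^sup>+x. ennreal (X x) \<partial>M)"
  proof (rule nn_integral_mono_AE)
    show "AE x in M. emeasure (distr M borel U) (Pair (X x) -` T) \<le> ennreal (X x)"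
      using X_nonneg
    proof eventually_elim
      case (elim x)
      have "emeasure (distr M borel U) (Pair (X x) -` T)
          = prob {y \<in> space M. U y \<le> X x}"
        by (subst emeasure_distr)
           (auto simp: T_def emeasure_eq_measure intro!: arg_cong[where f = prob])
      then show ?case
        using stochastically_larger_uniform_le[OF U elim] by (simp add: ennreal_leI)
    qed
  qed
  finally show ?thesis .
qed

text \<open>Preimages under \<open>X\<close> lie in the limit \<sigma>-algebra, so the product rule
  holds for preimages. These form intersection-stable families, and independence extends to the
  \<sigma>-algebras that they generate.\<close>

lemma (in nonneg_supermartingale) indep_var_if_indep_of_filtration:
  assumes [measurable]: "U \<in> borel_measurable P"
    and indep: "indep_of_filtration P F U"
    and X: "X \<in> borel_measurable (filtration_limit P F)"
  shows "indep_var borel X borel U"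
proof -
  have sets: "sets (filtration_limit P F) \<subseteq> events"
  proof -
    have "(\<Union>t. sets (F t)) \<subseteq> events"
      using subalgebra_F by (auto simp: subalgebra_def)
    then show ?thesis
      using sets.sets_into_space
      by (subst filtration_limit_def, subst sets_measure_of) (auto intro!: sets.sigma_sets_subset)
  qed
  have [measurable]: "X \<in> borel_measurable P"
    by (rule measurable_from_subalg[OF _ X]) (simp add: subalgebra_def space_filtration_limit sets)
  have "indep_set {X -` A \<inter> space P | A. A \<in> sets borel} {U -` A \<inter> space P | A. A \<in> sets borel}"
  proof (rule indep_setI)
    fix S T
    assume S: "S \<in> {X -` A \<inter> space P | A. A \<in> sets borel}"
      and T: "T \<in> {U -` A \<inter> space P | A. A \<in> sets borel}"
    have "S \<in> sets (filtration_limit P F)"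
      using S measurable_sets[OF X] by (auto simp: space_filtration_limit)
    moreover have "T \<in> sets (vimage_algebra (space P) U borel)"
      using T by (auto intro: in_vimage_algebra)
    ultimately have "prob (T \<inter> S) = prob T * prob S"
      using indep unfolding indep_of_filtration_def by (intro indep_setD)
    then show "prob (S \<inter> T) = prob S * prob T"
      by (simp add: Int_commute mult.commute)
  qed auto
  moreover have "Int_stable {f -` A \<inter> space P | A. A \<in> sets borel}" for f :: "'a \<Rightarrow> real"
  proof (safe intro!: Int_stableI)
    fix A B :: "real set" assume "A \<in> sets borel" "B \<in> sets borel"
    then show "\<exists>C. f -` A \<inter> space P \<inter> (f -` B \<inter> space P) = f -` C \<inter> space P \<and> C \<in> sets borel"
      by (intro exI[of _ "A \<inter> B"]) auto
  qed
  ultimately show ?thesis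
    unfolding indep_var_eq by (intro conjI indep_set_sigma_sets) auto
qed

theorem theorem4p1:
  fixes P :: "'a measure" and F :: "nat \<Rightarrow> 'a measure" and M :: "nat \<Rightarrow> 'a \<Rightarrow> real"
    and U :: "'a \<Rightarrow> real" and \<tau> :: "'a \<Rightarrow> enat" and a :: real
  assumes "prob_space P"
    and "prob_filtration P F"
    and "supermartingale P F M"
    and "\<And>t. AE x in P. 0 \<le> M t x"
    and "prob_space.expectation P (M 0) \<le> 1"
    and "U \<in> borel_measurable P"
    and "stochastically_larger_uniform P U"
    and "indep_of_filtration P F U"
    and "a > 0"
    and "enat_stopping_time P F \<tau>"
  shows "measure P {x \<in> space P. stopped_value M \<tau> x \<ge> U x / a} \<le> a"
proof -
  interpret prob_space P by fact
  interpret nonneg_supermartingale P F M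
    using assms by unfold_locales
  \<comment> \<open>Scaling by \<open>a\<close> turns the threshold \<open>U / a\<close> into
    \<open>U\<close>, so that the randomised Markov inequality applies and yields \<open>a\<close>
    times the integral of the stopped value.\<close>
  let ?X = "\<lambda>x. a * stopped_value M \<tau> x"
  note [measurable] = measurable_stopped_value[OF filtration adapted[OF order_refl] assms(10)]
  have "ennreal (prob {x \<in> space P. stopped_value M \<tau> x \<ge> U x / a})
      = emeasure P {x \<in> space P. U x \<le> ?X x}"
    using \<open>a > 0\<close> by (simp add: emeasure_eq_measure field_simps)
  also have "\<dots> \<le> (\<integral>\<^sup>+x. ennreal (?X x) \<partial>P)"
  proof (rule emeasure_le_randomised_threshold)
    show "indep_var borel ?X borel U"
      using assms(6,8) stopped_value_filtration_limit[OF assms(10)]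
      by (intro indep_var_if_indep_of_filtration) auto
    show "AE x in P. 0 \<le> ?X x"
      using AE_stopped_value_nonneg[of \<tau>] \<open>a > 0\<close> by (auto elim: eventually_mono)
  qed fact
  also have "\<dots> = ennreal a * (\<integral>\<^sup>+x. ennreal (stopped_value M \<tau> x) \<partial>P)"
    using \<open>a > 0\<close> by (simp add: ennreal_mult' nn_integral_cmult)
  also have "\<dots> \<le> ennreal a * ennreal 1"
    using nn_integral_stopped_value_le[OF assms(10)] ennreal_leI[OF assms(5)]
    by (intro mult_left_mono) (auto intro: order_trans)
  finally show ?thesis
    using \<open>a > 0\<close> by simp
qed

end
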